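(* Let $r_1,r_2,\rho_1,\rho_2$ be real numbers and let $L$ be the Dunkl shift operator $$L=\frac{(x-\rho_1)(x-\rho_2)}{2x}(I-R)+\frac{(x-r_1+1/2)(x-r_2+1/2)}{2x+1}(T^+R-I).$$ Put $\kappa=\rho_1+\rho_2-r_1-r_2+\tfrac12$ and define the operators $$X=2L+\kappa,\qquad Y=2x+\tfrac12,$$ $$Z=\frac{r_1r_2}{x+1/2}+\frac{\rho_1\rho_2}{x}-\frac{(x-\rho_1)(x-\rho_2)}{x}R-\frac{(x-r_1+1/2)(x-r_2+1/2)}{x+1/2}T^+R.$$ Then $$\{X,Y\}=Z+\omega_3,\qquad \{Z,Y\}=X+\omega_1,\qquad \{X,Z\}=Y+\omega_2,$$ where $$\omega_1=4(\rho_1\rho_2+r_1r_2),\quad \omega_2=2(\rho_1^2+\rho_2^2-r_1^2-r_2^2),\quad \omega_3=4(\rho_1\rho_2-r_1r_2).$$ Moreover, the operator $Q=X^2+Y^2+Z^2$ commutes with $X,Y,Z$, and in this realization it is the scalar $$Q=2(\rho_1^2+\rho_2^2+r_1^2+r_2^2)-\tfrac14 .$$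
   Context: $I$ is the identity, $Rf(x)=f(-x)$, $T^+Rf(x)=f(-x-1)$, and a function of $x$ (or a constant) stands for the corresponding multiplication operator; $\{A,B\}=AB+BA$ is the anticommutator. The operators act on polynomials in $x$. *)

theory Defs
  imports "HOL-Computational_Algebra.Computational_Algebra"
begin

definition reflect :: "real poly \<Rightarrow> real poly" where
  "reflect f = pcompose f [:0, -1:]"

text \<open>\<open>shift_reflect\<close> is \<open>T\<^sup>+R\<close>, that is, \<open>f(x)\<close> goes to \<open>f(-x-1)\<close>.\<close>

definition shift_reflect :: "real poly \<Rightarrow> real poly" where
  "shift_reflect f = pcompose f [:-1, -1:]"

text \<open>The coefficients of the operators are rational functions, so the operators are first
  written down with values in the field of rational functions.\<close>

abbreviation var :: "real poly fract" where
  "var \<equiv> to_fract [:0, 1:]"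

abbreviation cst :: "real \<Rightarrow> real poly fract" where
  "cst c \<equiv> to_fract [:c:]"

definition dunkl_L_rat :: "real \<Rightarrow> real \<Rightarrow> real \<Rightarrow> real \<Rightarrow> real poly \<Rightarrow> real poly fract" where
  "dunkl_L_rat r1 r2 \<rho>1 \<rho>2 f =
     (var - cst \<rho>1) * (var - cst \<rho>2) / (2 * var) * to_fract (f - reflect f)
   + (var - cst r1 + 1/2) * (var - cst r2 + 1/2) / (2 * var + 1) * to_fract (shift_reflect f - f)"

definition dunkl_Z_rat :: "real \<Rightarrow> real \<Rightarrow> real \<Rightarrow> real \<Rightarrow> real poly \<Rightarrow> real poly fract" where
  "dunkl_Z_rat r1 r2 \<rho>1 \<rho>2 f =
     cst (r1 * r2) / (var + 1/2) * to_fract f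
   + cst (\<rho>1 * \<rho>2) / var * to_fract f
   - (var - cst \<rho>1) * (var - cst \<rho>2) / var * to_fract (reflect f)
   - (var - cst r1 + 1/2) * (var - cst r2 + 1/2) / (var + 1/2) * to_fract (shift_reflect f)"

text \<open>The poles cancel when the operators are applied to polynomials, so that they are operators
  on polynomials; lemmas \<open>to_fract_dunkl_L\<close> and \<open>to_fract_dunkl_Z\<close> show that the
  inverse of the embedding \<open>to_fract\<close> is only applied within its range.\<close>

definition dunkl_L :: "real \<Rightarrow> real \<Rightarrow> real \<Rightarrow> real \<Rightarrow> real poly \<Rightarrow> real poly" where
  "dunkl_L r1 r2 \<rho>1 \<rho>2 f = the_inv to_fract (dunkl_L_rat r1 r2 \<rho>1 \<rho>2 f)"

definition dunkl_Z :: "real \<Rightarrow> real \<Rightarrow> real \<Rightarrow> real \<Rightarrow> real poly \<Rightarrow> real poly" where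
  "dunkl_Z r1 r2 \<rho>1 \<rho>2 f = the_inv to_fract (dunkl_Z_rat r1 r2 \<rho>1 \<rho>2 f)"

definition anticommutator ::
  "(real poly \<Rightarrow> real poly) \<Rightarrow> (real poly \<Rightarrow> real poly) \<Rightarrow> real poly \<Rightarrow> real poly" where
  "anticommutator A B = (\<lambda>f. A (B f) + B (A f))"

lemma to_fract_the_inv:
  "q = to_fract (g :: real poly) \<Longrightarrow> to_fract (the_inv to_fract q) = q"
  by (simp add: the_inv_f_f inj_def)

lemma cst_half: "cst (1/2) = 1/2"
proof -
  have "2 * cst (1/2) = cst (1/2) + cst (1/2)"
    by simp
  also have "\<dots> = to_fract [:1/2 + 1/2:]"
    by (simp only: to_fract_add [symmetric] add_pCons add_0)
  also have "\<dots> = 1"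
    by (simp flip: one_pCons)
  finally show ?thesis
    by (simp add: field_simps)
qed

lemma var_half: "to_fract [:1/2, 1:] = var + 1/2"
  unfolding cst_half [symmetric] to_fract_add [symmetric] by simp

lemma var_plus_cst_nonzero: "var + 1/2 \<noteq> 0"
  unfolding var_half [symmetric] by simp

lemma to_fract_dunkl_L:
  "to_fract (dunkl_L r1 r2 \<rho>1 \<rho>2 f) = dunkl_L_rat r1 r2 \<rho>1 \<rho>2 f"
proof -
  have "[:0, 1:] dvd f - reflect f"
    using poly_eq_0_iff_dvd [of "f - reflect f" 0] by (simp add: reflect_def poly_pcompose)
  then obtain g where g: "f - reflect f = [:0, 1:] * g" ..
  have "[:1/2, 1:] dvd shift_reflect f - f"
    using poly_eq_0_iff_dvd [of "shift_reflect f - f" "-1/2"]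
    by (simp add: shift_reflect_def poly_pcompose)
  then obtain h where h: "shift_reflect f - f = [:1/2, 1:] * h" ..
  have v0: "var \<noteq> 0" by simp
  have halve: "a / (2 * s) * (s * u) = a * (1/2) * u" if "s \<noteq> 0" for a s u :: "real poly fract"
    using that by simp
  have v1: "2 * var + 1 = 2 * (var + 1/2)" by (simp add: algebra_simps)
  have "dunkl_L_rat r1 r2 \<rho>1 \<rho>2 f =
      (var - cst \<rho>1) * (var - cst \<rho>2) * (1/2) * to_fract g
    + (var - cst r1 + 1/2) * (var - cst r2 + 1/2) * (1/2) * to_fract h"
    unfolding dunkl_L_rat_def g h v1 to_fract_mult var_half
    by (simp only: halve [OF v0] halve [OF var_plus_cst_nonzero])
  also have "\<dots> = to_fract
      (([:0, 1:] - [:\<rho>1:]) * ([:0, 1:] - [:\<rho>2:]) * [:1/2:] * g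
     + ([:0, 1:] - [:r1:] + [:1/2:]) * ([:0, 1:] - [:r2:] + [:1/2:]) * [:1/2:] * h)"
    by (simp only: to_fract_add to_fract_diff to_fract_mult cst_half)
  finally show ?thesis
    unfolding dunkl_L_def by (rule to_fract_the_inv)
qed

lemma to_fract_dunkl_Z:
  "to_fract (dunkl_Z r1 r2 \<rho>1 \<rho>2 f) = dunkl_Z_rat r1 r2 \<rho>1 \<rho>2 f"
proof -
  define p where "p = [:\<rho>1 * \<rho>2:] * f - ([:0, 1:] - [:\<rho>1:]) * ([:0, 1:] - [:\<rho>2:]) * reflect f"
  define q where "q = [:r1 * r2:] * f
    - ([:0, 1:] - [:r1:] + [:1/2:]) * ([:0, 1:] - [:r2:] + [:1/2:]) * shift_reflect f"
  have "[:0, 1:] dvd p"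
    using poly_eq_0_iff_dvd [of p 0] by (simp add: p_def reflect_def poly_pcompose)
  then obtain g where g: "p = [:0, 1:] * g" ..
  have "poly q (-1/2) = 0"
    by (simp add: q_def shift_reflect_def poly_pcompose field_simps)
  then have "[:1/2, 1:] dvd q"
    by (simp add: poly_eq_0_iff_dvd)
  then obtain h where h: "q = [:1/2, 1:] * h" ..
  have v0: "var \<noteq> 0" by simp
  have "dunkl_Z_rat r1 r2 \<rho>1 \<rho>2 f = to_fract p / var + to_fract q / (var + 1/2)"
    unfolding dunkl_Z_rat_def p_def q_def to_fract_add to_fract_diff to_fract_mult cst_half
    by (simp only: diff_divide_distrib times_divide_eq_left)
  also have "\<dots> = to_fract (g + h)"
    unfolding g h to_fract_mult to_fract_add var_half
    using v0 var_plus_cst_nonzero by (simp del: to_fract_eq_0_iff)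
  finally show ?thesis
    unfolding dunkl_Z_def by (rule to_fract_the_inv)
qed

end

theory Submission
  imports Defs
begin

text \<open>
  The operators split as \<open>X = U - V\<close> and \<open>Z = U + V\<close>, where each of \<open>U\<close> and \<open>V\<close> involves only one
  of the two reflections. With \<open>t = x - c\<close> and \<open>S\<close> the reflection \<open>f(x) \<mapsto> f(2c - x)\<close>, both are of
  the form \<open>(p q - (t - p) (t - q) S) / t\<close>: \<open>U\<close> for \<open>c = 0\<close> and the parameters \<open>\<rho>1, \<rho>2\<close>, and \<open>V\<close>
  for \<open>c = -1/2\<close> and the parameters \<open>r1, r2\<close>. Since \<open>t S = - S t\<close>, an operator \<open>W\<close> of
  this form satisfies \<open>W^2 = p^2 + q^2 - t^2\<close> and \<open>{W, t} = 2 p q\<close> (lemmas \<open>half_op_half_op\<close> and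
  \<open>half_op_anticomm\<close>). All assertions follow from these two identities. In
  \<open>{X, Z} = 2 (U^2 - V^2)\<close> and \<open>X^2 + Z^2 = 2 (U^2 + V^2)\<close> the mixed products cancel, and
  \<open>Y = 2 x + 1/2 = 2 (x + 1/2) - 1/2\<close> gives \<open>{U, Y} = 4 \<rho>1 \<rho>2 + U\<close> and
  \<open>{V, Y} = 4 r1 r2 - V\<close>, hence the relations for \<open>{X, Y}\<close> and \<open>{Z, Y}\<close>. Finally, \<open>Q\<close> commutes
  with linear operators because it is a scalar.
\<close>

section \<open>Reflection operators with one centre\<close>

definition refl_about :: "real \<Rightarrow> real poly \<Rightarrow> real poly" where
  "refl_about c f = pcompose f [:2 * c, -1:]"

text \<open>The division is exact, by \<open>half_op_eq\<close>.\<close>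

definition half_op :: "real \<Rightarrow> real \<Rightarrow> real \<Rightarrow> real poly \<Rightarrow> real poly" where
  "half_op c p q f =
     ([:p * q:] * f - ([:- c, 1:] - [:p:]) * ([:- c, 1:] - [:q:]) * refl_about c f) div [:- c, 1:]"

lemma refl_about_mult: "refl_about c (f * g) = refl_about c f * refl_about c g"
  by (simp add: refl_about_def pcompose_mult)

lemma refl_about_diff: "refl_about c (f - g) = refl_about c f - refl_about c g"
  by (simp add: refl_about_def pcompose_diff)

lemma refl_about_const: "refl_about c [:a:] = [:a:]"
  by (simp add: refl_about_def)

lemma refl_about_linear: "refl_about c [:- c, 1:] = - [:- c, 1:]"
  by (simp add: refl_about_def pcompose_pCons)

lemma refl_about_refl_about: "refl_about c (refl_about c f) = f"
  by (simp add: refl_about_def pcompose_pCons flip: pcompose_assoc)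

text \<open>Since \<open>c\<close> is the fixed point of the reflection, the numerator takes the value
  \<open>p q f(c) - (-p) (-q) f(c) = 0\<close> there.\<close>

lemma half_op_eq:
  "[:- c, 1:] * half_op c p q f =
     [:p * q:] * f - ([:- c, 1:] - [:p:]) * ([:- c, 1:] - [:q:]) * refl_about c f"
    (is "_ = ?n")
proof -
  have "poly ?n c = 0"
    by (simp add: refl_about_def poly_pcompose algebra_simps)
  then have "[:- c, 1:] dvd ?n"
    by (simp only: poly_eq_0_iff_dvd)
  then show ?thesis
    by (simp only: half_op_def dvd_mult_div_cancel)
qed

lemma half_op_add: "half_op c p q (f + g) = half_op c p q f + half_op c p q g"
proof -
  have "[:- c, 1:] * half_op c p q (f + g) = [:- c, 1:] * (half_op c p q f + half_op c p q g)"
    unfolding distrib_left half_op_eq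
    by (simp only: refl_about_def pcompose_add) (simp only: algebra_simps)
  then show ?thesis
    by (subst (asm) mult_cancel_left) simp
qed

lemma half_op_const_mult: "half_op c p q ([:a:] * f) = [:a:] * half_op c p q f"
proof -
  have "[:- c, 1:] * half_op c p q ([:a:] * f) = [:a:] * ([:- c, 1:] * half_op c p q f)"
    unfolding half_op_eq refl_about_mult refl_about_const
    by (simp only: algebra_simps)
  then have "[:- c, 1:] * half_op c p q ([:a:] * f) = [:- c, 1:] * ([:a:] * half_op c p q f)"
    by (simp only: mult.left_commute)
  then show ?thesis
    by (subst (asm) mult_cancel_left) simp
qed

lemma half_op_smult: "half_op c p q (smult a f) = smult a (half_op c p q f)"
  using half_op_const_mult [of c p q a f] by simp

lemma half_op_diff: "half_op c p q (f - g) = half_op c p q f - half_op c p q g"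
  using half_op_add [of c p q "f - g" g] by (simp add: algebra_simps)

text \<open>The reflection terms cancel because the reflection anticommutes with multiplication by
  \<open>x - c\<close>.\<close>

lemma half_op_anticomm:
  "half_op c p q ([:- c, 1:] * f) + [:- c, 1:] * half_op c p q f = [:2 * (p * q):] * f"
proof -
  define t P N S where "t = [:- c, 1:]" and "P = [:p * q:]"
    and "N = (t - [:p:]) * (t - [:q:])" and "S = refl_about c f"
  have eq: "t * half_op c p q g = P * g - N * refl_about c g" for g
    unfolding t_def P_def N_def by (rule half_op_eq)
  have St: "refl_about c (t * f) = - (t * S)"
    by (simp only: refl_about_mult t_def refl_about_linear S_def mult_minus_left)
  have "t * (half_op c p q (t * f) + t * half_op c p q f) = t * ((P + P) * f)"
    unfolding distrib_left eq [of "t * f"] St eq [of f] S_def [symmetric]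
    by (simp only: algebra_simps)
  moreover have "P + P = [:2 * (p * q):]"
    by (simp add: P_def)
  moreover have "t \<noteq> 0"
    by (simp add: t_def)
  ultimately have "half_op c p q (t * f) + t * half_op c p q f = [:2 * (p * q):] * f"
    by (metis mult_left_cancel)
  then show ?thesis
    by (simp only: t_def)
qed

text \<open>Reflecting the defining equation of \<open>half_op c p q f\<close> determines the reflection of
  \<open>half_op c p q f\<close>. In the square, the terms with \<open>refl_about c f\<close> cancel, and the
  rest is \<open>(p^2 q^2 - (t^2 - p^2) (t^2 - q^2)) / t^2\<close>, whose pole cancels.\<close>

lemma half_op_half_op:
  "half_op c p q (half_op c p q f) = ([:p\<^sup>2 + q\<^sup>2:] - [:- c, 1:]\<^sup>2) * f"
proof -
  define t P Q S U where "t = [:- c, 1:]" and "P = [:p:]" and "Q = [:q:]"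
    and "S = refl_about c f" and "U = half_op c p q f"
  have PQ: "[:p * q:] = P * Q"
    by (simp add: P_def Q_def)
  have eq: "t * half_op c p q g = P * Q * g - (t - P) * (t - Q) * refl_about c g" for g
    unfolding PQ [symmetric] unfolding t_def P_def Q_def by (rule half_op_eq)
  have tU: "t * U = P * Q * f - (t - P) * (t - Q) * S"
    unfolding U_def S_def by (rule eq)
  have "refl_about c (t * U) = P * Q * S - (- t - P) * (- t - Q) * f"
    unfolding tU refl_about_diff refl_about_mult S_def refl_about_refl_about
    by (simp only: t_def P_def Q_def refl_about_const refl_about_linear)
  moreover have "refl_about c (t * U) = - (t * refl_about c U)"
    by (simp only: refl_about_mult t_def refl_about_linear mult_minus_left)
  ultimately have tSU: "t * refl_about c U = (t + P) * (t + Q) * f - P * Q * S"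
    by (simp add: algebra_simps)
  have "t * (t * half_op c p q U) = P * Q * (t * U) - (t - P) * (t - Q) * (t * refl_about c U)"
    unfolding eq [of U] by (simp only: algebra_simps)
  also have "\<dots> = t * (t * ((P * P + Q * Q - t * t) * f))"
    unfolding tU tSU by algebra
  finally have "t * (t * half_op c p q U) = t * (t * ((P * P + Q * Q - t * t) * f))" .
  moreover have "t \<noteq> 0"
    by (simp add: t_def)
  ultimately have "half_op c p q U = (P * P + Q * Q - t * t) * f"
    by (metis mult_left_cancel)
  moreover have "P * P + Q * Q = [:p\<^sup>2 + q\<^sup>2:]"
    by (simp add: P_def Q_def power2_eq_square)
  ultimately show ?thesis
    by (simp only: U_def t_def power2_eq_square)
qed

section \<open>Decomposition of the Dunkl operators\<close>

lemma to_fract_half_op: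
  "to_fract (half_op c p q f) = (cst p * cst q * to_fract f
     - (to_fract [:- c, 1:] - cst p) * (to_fract [:- c, 1:] - cst q) * to_fract (refl_about c f))
     / to_fract [:- c, 1:]"
proof -
  have "[:p * q:] = [:p:] * [:q:]"
    by simp
  then have "to_fract [:- c, 1:] * to_fract (half_op c p q f) = cst p * cst q * to_fract f
     - (to_fract [:- c, 1:] - cst p) * (to_fract [:- c, 1:] - cst q) * to_fract (refl_about c f)"
    using arg_cong [OF half_op_eq [of c p q f], of to_fract]
    by (simp only: to_fract_mult to_fract_diff)
  moreover have "to_fract [:- c, 1:] \<noteq> 0"
    by simp
  ultimately show ?thesis
    by (metis nonzero_mult_div_cancel_left)
qed

lemma reflect_eq: "reflect = refl_about 0"
  by (simp add: fun_eq_iff reflect_def refl_about_def)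

lemma shift_reflect_eq: "shift_reflect = refl_about (-1/2)"
  by (simp add: fun_eq_iff shift_reflect_def refl_about_def)

lemma to_fract_half_op_0:
  "to_fract (half_op 0 p q f) = (cst p * cst q * to_fract f
     - (var - cst p) * (var - cst q) * to_fract (reflect f)) / var"
  using to_fract_half_op [of 0 p q f] by (simp add: reflect_eq)

lemma to_fract_half_op_half:
  "to_fract (half_op (-1/2) p q f) = (cst p * cst q * to_fract f
     - (var - cst p + 1/2) * (var - cst q + 1/2) * to_fract (shift_reflect f)) / (var + 1/2)"
proof -
  have "[:- (-1/2), 1:] = [:1/2, 1 :: real:]"
    by simp
  moreover have "var + 1/2 - cst a = var - cst a + 1/2" for a
    by simp
  ultimately show ?thesis
    using to_fract_half_op [of "-1/2" p q f] by (simp only: var_half shift_reflect_eq)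
qed

lemma cst_mult: "cst (a * b) = cst a * cst b"
  by (simp flip: to_fract_mult)

lemma dunkl_Z_eq: "dunkl_Z r1 r2 \<rho>1 \<rho>2 f = half_op 0 \<rho>1 \<rho>2 f + half_op (-1/2) r1 r2 f"
proof -
  have "to_fract (dunkl_Z r1 r2 \<rho>1 \<rho>2 f) =
      to_fract (half_op 0 \<rho>1 \<rho>2 f + half_op (-1/2) r1 r2 f)"
    unfolding to_fract_dunkl_Z dunkl_Z_rat_def to_fract_add to_fract_half_op_0
      to_fract_half_op_half cst_mult
    by (simp only: diff_divide_distrib times_divide_eq_left add_diff_eq diff_add_eq)
  then show ?thesis
    by (simp only: to_fract_eq_iff)
qed

text \<open>The constant \<open>\<kappa>\<close> compensates the polynomial part of the coefficient of the identity: with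
  \<open>w = x + 1/2\<close>, the coefficient \<open>(x - \<rho>1) (x - \<rho>2) / x - (w - r1) (w - r2) / w\<close> in \<open>2 L\<close> equals
  \<open>\<rho>1 \<rho>2 / x - r1 r2 / w - \<kappa>\<close>.\<close>

lemma dunkl_L_eq:
  assumes "\<kappa> = \<rho>1 + \<rho>2 - r1 - r2 + 1/2"
  shows "smult 2 (dunkl_L r1 r2 \<rho>1 \<rho>2 f) + smult \<kappa> f =
    half_op 0 \<rho>1 \<rho>2 f - half_op (-1/2) r1 r2 f"
proof -
  define v w where "v = var" and "w = var + 1/2"
  have nz: "v \<noteq> 0" "w \<noteq> 0"
    using var_plus_cst_nonzero by (simp_all add: v_def w_def)
  have vw: "v + 1/2 = w" and diff: "w - v = 1/2"
    by (simp_all add: v_def w_def)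
  from assms have "[:\<kappa>:] = [:\<rho>1:] + [:\<rho>2:] - [:r1:] - [:r2:] + [:1/2:]"
    by simp
  then have \<kappa>: "cst \<kappa> = cst \<rho>1 + cst \<rho>2 - cst r1 - cst r2 + (w - v)"
    by (simp only: to_fract_add to_fract_diff cst_half diff)
  have "[:2:] = [:1/2:] + [:1/2:] + [:1 :: real:]"
    by simp
  then have [simp]: "cst 2 = 2"
    by (simp only: to_fract_add cst_half one_pCons [symmetric] to_fract_1 field_sum_of_halves one_add_one)
  have shift: "v - cst a + 1/2 = w - cst a" for a
    by (simp add: v_def w_def)
  have "2 * v + 1 = 2 * w"
    by (simp add: v_def w_def algebra_simps)
  then have two: "2 * (a / (2 * v) * b + d / (2 * v + 1) * e) = a * b / v + d * e / w"
    for a b d e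
    by (simp only:) (use nz in \<open>simp add: field_simps\<close>)
  have part: "(u - a) * (u - b) / u = u - a - b + a * b / u" if "u \<noteq> 0" for u a b :: "real poly fract"
    using that by (simp add: field_simps)
  have "to_fract (smult 2 (dunkl_L r1 r2 \<rho>1 \<rho>2 f) + smult \<kappa> f) =
      2 * dunkl_L_rat r1 r2 \<rho>1 \<rho>2 f + cst \<kappa> * to_fract f"
    using to_fract_mult [of "[:2 :: real:]"] to_fract_mult [of "[:\<kappa>:]"]
    by (simp add: to_fract_dunkl_L)
  also have "\<dots> = (v - cst \<rho>1) * (v - cst \<rho>2) / v * (to_fract f - to_fract (reflect f))
      + (w - cst r1) * (w - cst r2) / w * (to_fract (shift_reflect f) - to_fract f)
      + cst \<kappa> * to_fract f"
    unfolding dunkl_L_rat_def v_def [symmetric] two shift to_fract_diff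
    by (simp only: times_divide_eq_left)
  also have "\<dots> = (cst \<rho>1 * cst \<rho>2 / v - cst r1 * cst r2 / w) * to_fract f
      - (v - cst \<rho>1) * (v - cst \<rho>2) / v * to_fract (reflect f)
      + (w - cst r1) * (w - cst r2) / w * to_fract (shift_reflect f)"
    unfolding part [OF nz(1)] part [OF nz(2)] \<kappa> by (simp only: algebra_simps)
  also have "\<dots> = to_fract (half_op 0 \<rho>1 \<rho>2 f - half_op (-1/2) r1 r2 f)"
    unfolding to_fract_diff to_fract_half_op_0 to_fract_half_op_half
      v_def [symmetric] vw shift
    by (simp only: diff_divide_distrib times_divide_eq_left left_diff_distrib [of "_ / _" "_ / _"])
  finally show ?thesis
    by (simp only: to_fract_eq_iff)
qed

section \<open>The algebra relations\<close>

theorem mainTheorem5: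
  fixes r1 r2 \<rho>1 \<rho>2 \<kappa> \<omega>1 \<omega>2 \<omega>3 :: real
    and X Y Z Q :: "real poly \<Rightarrow> real poly"
  assumes "\<kappa> = \<rho>1 + \<rho>2 - r1 - r2 + 1/2"
    and "X = (\<lambda>f. smult 2 (dunkl_L r1 r2 \<rho>1 \<rho>2 f) + smult \<kappa> f)"
    and "Y = (\<lambda>f. (smult 2 [:0, 1:] + [:1/2:]) * f)"
    and "Z = dunkl_Z r1 r2 \<rho>1 \<rho>2"
    and "Q = (\<lambda>f. X (X f) + Y (Y f) + Z (Z f))"
    and "\<omega>1 = 4 * (\<rho>1 * \<rho>2 + r1 * r2)"
    and "\<omega>2 = 2 * (\<rho>1\<^sup>2 + \<rho>2\<^sup>2 - r1\<^sup>2 - r2\<^sup>2)"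
    and "\<omega>3 = 4 * (\<rho>1 * \<rho>2 - r1 * r2)"
  shows "anticommutator X Y = (\<lambda>f. Z f + smult \<omega>3 f)
    \<and> anticommutator Z Y = (\<lambda>f. X f + smult \<omega>1 f)
    \<and> anticommutator X Z = (\<lambda>f. Y f + smult \<omega>2 f)
    \<and> Q \<circ> X = X \<circ> Q \<and> Q \<circ> Y = Y \<circ> Q \<and> Q \<circ> Z = Z \<circ> Q
    \<and> Q = (\<lambda>f. smult (2 * (\<rho>1\<^sup>2 + \<rho>2\<^sup>2 + r1\<^sup>2 + r2\<^sup>2) - 1/4) f)"
proof -
  define U V where "U = half_op 0 \<rho>1 \<rho>2" and "V = half_op (-1/2) r1 r2"
  have X: "X f = U f - V f" for f
    unfolding assms(2) U_def V_def by (rule dunkl_L_eq [OF assms(1)])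
  have Z: "Z f = U f + V f" for f
    unfolding assms(4) U_def V_def by (rule dunkl_Z_eq)
  have Y: "Y f = [:1/2, 2:] * f" for f
    by (simp add: assms(3))
  note lin = U_def V_def half_op_add half_op_diff half_op_smult
  have UU: "U (U f) = ([:\<rho>1\<^sup>2 + \<rho>2\<^sup>2:] - [:0, 1:]\<^sup>2) * f" for f
    using half_op_half_op [of 0 \<rho>1 \<rho>2 f] by (simp add: U_def)
  have VV: "V (V f) = ([:r1\<^sup>2 + r2\<^sup>2:] - [:1/2, 1:]\<^sup>2) * f" for f
    using half_op_half_op [of "-1/2" r1 r2 f] by (simp add: V_def)
  have UY: "U (Y f) + Y (U f) = smult (4 * (\<rho>1 * \<rho>2)) f + U f" for f
  proof -
    have Y': "Y g = smult 2 ([:- 0, 1:] * g) + smult (1/2) g" for g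
      by (simp add: Y)
    have "U (Y f) + Y (U f) = smult 2 (U ([:- 0, 1:] * f) + [:- 0, 1:] * U f)
        + smult (1/2 + 1/2) (U f)"
      unfolding Y' U_def half_op_add half_op_smult smult_add_left smult_add_right
      by (simp only: algebra_simps)
    then show ?thesis
      unfolding U_def half_op_anticomm by simp
  qed
  have VY: "V (Y f) + Y (V f) = smult (4 * (r1 * r2)) f - V f" for f
  proof -
    have Y': "Y g = smult 2 ([:- (-1/2), 1:] * g) - smult (1/2) g" for g
    proof -
      have "[:1/2, 2:] = smult 2 [:- (-1/2), 1:] - [:1/2 :: real:]"
        by simp
      then show ?thesis
        unfolding Y by (simp only: left_diff_distrib mult_smult_left) simp
    qed
    have "V (Y f) + Y (V f) = smult 2 (V ([:- (-1/2), 1:] * f) + [:- (-1/2), 1:] * V f)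
        - smult (1/2 + 1/2) (V f)"
      unfolding Y' V_def half_op_diff half_op_smult smult_add_left smult_add_right
      by (simp only: algebra_simps)
    then show ?thesis
      unfolding V_def half_op_anticomm by simp
  qed
  have Yadd: "Y (f + g) = Y f + Y g" and Ydiff: "Y (f - g) = Y f - Y g" for f g
    by (simp_all only: Y distrib_left right_diff_distrib)
  have XY: "anticommutator X Y = (\<lambda>f. Z f + smult \<omega>3 f)"
  proof
    fix f
    have "anticommutator X Y f = (U (Y f) + Y (U f)) - (V (Y f) + Y (V f))"
      by (simp add: anticommutator_def X Ydiff)
    also have "\<dots> = Z f + smult \<omega>3 f"
      unfolding UY VY assms(8) by (simp add: Z smult_diff_left right_diff_distrib)
    finally show "anticommutator X Y f = Z f + smult \<omega>3 f" .
  qed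
  have ZY: "anticommutator Z Y = (\<lambda>f. X f + smult \<omega>1 f)"
  proof
    fix f
    have "anticommutator Z Y f = (U (Y f) + Y (U f)) + (V (Y f) + Y (V f))"
      by (simp add: anticommutator_def Z Yadd)
    also have "\<dots> = X f + smult \<omega>1 f"
      unfolding UY VY assms(6) by (simp add: X smult_add_left distrib_left)
    finally show "anticommutator Z Y f = X f + smult \<omega>1 f" .
  qed
  have Uadd: "U (f + g) = U f + U g" and Udiff: "U (f - g) = U f - U g"
    and Vadd: "V (f + g) = V f + V g" and Vdiff: "V (f - g) = V f - V g" for f g
    by (simp_all add: lin)
  have XZ: "anticommutator X Z = (\<lambda>f. Y f + smult \<omega>2 f)"
  proof
    fix f
    have "anticommutator X Z f = (U (U f) + U (U f)) - (V (V f) + V (V f))"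
      by (simp add: anticommutator_def X Z Uadd Udiff Vadd Vdiff)
    also have "\<dots> = ([:1/2, 2:] + [:\<omega>2:]) * f"
      unfolding UU VV distrib_right [symmetric] left_diff_distrib [symmetric]
      by (rule arg_cong [where f = "\<lambda>g. g * f"]) (simp add: assms(7) power2_eq_square)
    also have "\<dots> = Y f + smult \<omega>2 f"
      unfolding distrib_right Y by simp
    finally show "anticommutator X Z f = Y f + smult \<omega>2 f" .
  qed
  have Q: "Q = (\<lambda>f. smult (2 * (\<rho>1\<^sup>2 + \<rho>2\<^sup>2 + r1\<^sup>2 + r2\<^sup>2) - 1/4) f)"
  proof
    fix f
    have "Q f = U (U f) + U (U f) + (V (V f) + V (V f)) + [:1/2, 2:] * [:1/2, 2:] * f"
      unfolding assms(5) X Z Uadd Udiff Vadd Vdiff Y by (simp only: algebra_simps)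
    also have "\<dots> = [:2 * (\<rho>1\<^sup>2 + \<rho>2\<^sup>2 + r1\<^sup>2 + r2\<^sup>2) - 1/4:] * f"
      unfolding UU VV distrib_right [symmetric]
      by (rule arg_cong [where f = "\<lambda>g. g * f"]) (simp add: power2_eq_square)
    finally show "Q f = smult (2 * (\<rho>1\<^sup>2 + \<rho>2\<^sup>2 + r1\<^sup>2 + r2\<^sup>2) - 1/4) f"
      by simp
  qed
  have "X (smult a f) = smult a (X f)" "Y (smult a f) = smult a (Y f)"
    "Z (smult a f) = smult a (Z f)" for a f
    by (simp_all add: X Y Z lin smult_add_right smult_diff_right mult_smult_right del: mult_pCons_left)
  then have "Q \<circ> X = X \<circ> Q" "Q \<circ> Y = Y \<circ> Q" "Q \<circ> Z = Z \<circ> Q"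
    by (simp_all add: Q fun_eq_iff)
  with XY ZY XZ Q show ?thesis
    by blast
qed

end
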